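(* Let $q$ be a prime power and let $e,d$ be integers with $e>d>0$. Let $g\in\mathbb{F}_q[T]$ be monic of degree $e$, let $g^*$ be its square-free part and $(\lambda_1^*,\ldots,\lambda_e^* )$ the factorization pattern of $g^*$. Let $k$ be the least integer with $\lambda_k^*>0$. If $k\le d$, then the probability $\mathcal{P}_0=|B_0|/q^d$ that a uniformly random monic polynomial $f\in\mathbb{F}_q[T]$ of degree $d$ satisfies $\gcd(g,f)=1$ satisfies $$1-\frac{\lambda_k^*}{q^k}-\sum_{i=k+1}^d\frac{\lambda_i^*}{q^i}\le\mathcal{P}_0\le 1-\frac{\lambda_k^*}{q^k}+\binom{\lambda_k^*}{2}\frac{1}{q^{\min\{2k,d\}}}.$$ In particular, for $q>2e$ we have $\mathcal{P}_0>\frac12$.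
   Context: $B_0$ is the set of monic $f\in\mathbb{F}_q[T]$ of degree $d$ with $\gcd(g,f)=1$. The square-free part $g^*$ of $g$ is the product of the distinct monic irreducible factors of $g$ (without multiplicity). $g^*$ has factorization pattern $(\lambda_1^*,\ldots,\lambda_e^* )$ means $\lambda_i^*$ is the number of monic irreducible factors of $g^*$ of degree $i$, i.e. the number of distinct monic irreducible factors of $g$ of degree $i$. *)

theory Defs
  imports Complex_Main "HOL-Library.Cardinality" "HOL-Computational_Algebra.Computational_Algebra"
begin

(* The square-free part g* of g.  The library constants squarefree_part and radical are not used:
   the former is a different notion (n divided by its largest square divisor), the latter
   needs a normalization structure on 'a.  For g \<noteq> 0 over a finite field the index set is
   finite, so this is a genuine product. *)
definition monic_radical :: "'a::field poly \<Rightarrow> 'a poly" where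
  "monic_radical g = \<Prod>{p. lead_coeff p = 1 \<and> irreducible p \<and> p dvd g}"

(* Irreducible factors are counted without multiplicity, which is the usual factorization
   pattern when h is square-free. *)
definition factorization_pattern :: "'a::field poly \<Rightarrow> nat \<Rightarrow> nat" where
  "factorization_pattern h i =
     card {p. lead_coeff p = 1 \<and> irreducible p \<and> p dvd h \<and> degree p = i}"

(* gcd(g,f) = 1 is expressed by coprime, because gcd on 'a poly is not available for
   an arbitrary field type 'a. *)
definition B0 :: "'a::field poly \<Rightarrow> nat \<Rightarrow> 'a poly set" where
  "B0 g d = {f. lead_coeff f = 1 \<and> degree f = d \<and> coprime g f}"

definition P0 :: "'a::{finite,field} poly \<Rightarrow> nat \<Rightarrow> real" where
  "P0 g d = real (card (B0 g d)) / real CARD('a) ^ d"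

end

theory Submission
  imports Defs
begin

text \<open>
  A monic \<open>f\<close> of degree \<open>d\<close> fails to be coprime to \<open>g\<close> iff it lies in \<open>A p = {f. p dvd f}\<close> for
  some monic irreducible factor \<open>p\<close> of \<open>g\<close>, and \<open>A p\<close> has exactly \<open>q ^ (d - degree p)\<close> elements
  when \<open>degree p \<le> d\<close> and none otherwise. The union bound over all \<open>p\<close> gives the lower estimate;
  Bonferroni's inequality over the \<open>p\<close> of minimal degree \<open>k\<close> gives the upper one, since
  \<open>A p \<inter> A r = A (p * r)\<close> for distinct \<open>p\<close> and \<open>r\<close>. For \<open>q > 2 * e\<close>, the union bound loses at most
  \<open>1 / q\<close> for each of the at most \<open>e\<close> irreducible factors.
\<close>

section \<open>Counting monic multiples of a fixed degree\<close>

definition monic_polys :: "nat \<Rightarrow> 'a::field poly set" where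
  "monic_polys n = {f. lead_coeff f = 1 \<and> degree f = n}"

text \<open>The index set of the product defining \<open>monic_radical g\<close>, and the family
  over which all unions of bad sets run.\<close>

definition monic_irreducible_divisors :: "'a::field poly \<Rightarrow> 'a poly set" where
  "monic_irreducible_divisors g = {p. lead_coeff p = 1 \<and> irreducible p \<and> p dvd g}"

text \<open>Splitting off the constant coefficient reduces the degree by one; each such step
  contributes a factor \<open>CARD('a)\<close> to the count.\<close>

lemma monic_polys_Suc:
  "monic_polys (Suc n) = (\<lambda>(a, f). pCons a f) ` (UNIV \<times> monic_polys n :: ('a::field \<times> 'a poly) set)"
proof (intro set_eqI iffI)
  fix f :: "'a poly"
  assume f: "f \<in> monic_polys (Suc n)"
  obtain a h where [simp]: "f = pCons a h"
    by (cases f)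
  have "h \<in> monic_polys n"
    using f by (cases "h = 0") (auto simp: monic_polys_def)
  then show "f \<in> (\<lambda>(a, f). pCons a f) ` (UNIV \<times> monic_polys n)"
    by auto
qed (auto simp: monic_polys_def)

lemma card_monic_polys:
  "finite (monic_polys n :: 'a::{finite,field} poly set) \<and>
   card (monic_polys n :: 'a poly set) = CARD('a) ^ n"
proof (induction n)
  case 0
  have "monic_polys 0 = {1 :: 'a poly}"
    by (auto simp: monic_polys_def elim!: degree_eq_zeroE)
  then show ?case
    by simp
next
  case (Suc n)
  have "inj_on (\<lambda>(a, f). pCons a f) (UNIV \<times> monic_polys n :: ('a \<times> 'a poly) set)"
    by (auto simp: inj_on_def)
  then show ?case
    using Suc by (simp add: monic_polys_Suc card_image card_cartesian_product)
qed

lemma finite_monic_polys [simp]: "finite (monic_polys n :: 'a::{finite,field} poly set)"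
  using card_monic_polys by blast

text \<open>Multiplication by \<open>m\<close> is a bijection from the monic polynomials of degree
  \<open>d - degree m\<close> onto these multiples. When \<open>degree m\<close> exceeds
  \<open>d\<close>, a monic \<open>f\<close> of degree \<open>d\<close> is nonzero and too small to
  be a multiple.\<close>

lemma card_monic_multiples:
  fixes m :: "'a::{finite,field} poly"
  assumes m: "lead_coeff m = 1"
  shows "card {f \<in> monic_polys d. m dvd f} = (if degree m \<le> d then CARD('a) ^ (d - degree m) else 0)"
proof -
  have [simp]: "m \<noteq> 0"
    using m by auto
  show ?thesis
  proof (cases "degree m \<le> d")
    case True
    have "{f \<in> monic_polys d. m dvd f} = (*) m ` monic_polys (d - degree m)"
    proof (intro set_eqI iffI)
      fix f
      assume "f \<in> {f \<in> monic_polys d. m dvd f}"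
      then obtain h where h: "f = m * h" and f: "lead_coeff f = 1" "degree f = d"
        by (auto simp: monic_polys_def)
      then have "h \<noteq> 0"
        by auto
      then have "h \<in> monic_polys (d - degree m)"
        using f m h by (auto simp: monic_polys_def lead_coeff_mult degree_mult_eq coeff_mult_degree_sum)
      then show "f \<in> (*) m ` monic_polys (d - degree m)"
        using h by blast
    next
      fix f
      assume "f \<in> (*) m ` monic_polys (d - degree m)"
      then obtain h where h: "f = m * h" "lead_coeff h = 1" "degree h = d - degree m"
        by (auto simp: monic_polys_def)
      then have "h \<noteq> 0"
        by auto
      then have "degree f = d"
        using h True by (simp add: degree_mult_eq)
      moreover have "lead_coeff f = 1"
        using h m by (simp only: lead_coeff_mult mult_1)
      ultimately show "f \<in> {f \<in> monic_polys d. m dvd f}"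
        using h by (auto simp: monic_polys_def)
    qed
    moreover have "inj_on ((*) m) (monic_polys (d - degree m))"
      by (auto simp: inj_on_def)
    ultimately show ?thesis
      using True by (simp add: card_image card_monic_polys)
  next
    case False
    then have "{f \<in> monic_polys d. m dvd f} = {}"
      by (auto simp: monic_polys_def dest!: dvd_imp_degree_le)
    then show ?thesis
      using False by simp
  qed
qed

section \<open>Monic irreducible divisors\<close>

lemma monic_irreducible_dvd_imp_eq:
  fixes p r :: "'a::field poly"
  assumes p: "lead_coeff p = 1" "irreducible p" and r: "lead_coeff r = 1" "irreducible r"
    and dvd: "p dvd r"
  shows "p = r"
proof -
  obtain u where u: "r = p * u"
    using dvd by blast
  then have "is_unit u"
    using irreducibleD[OF r(2) u] p(2) by (auto simp: irreducible_def)
  then obtain c where c: "u = [:c:]"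
    by (auto simp: is_unit_poly_iff)
  have "lead_coeff r = lead_coeff p * lead_coeff u"
    unfolding u by (rule lead_coeff_mult)
  then have "c = 1"
    using p(1) r(1) c by simp
  then show ?thesis
    using u c by simp
qed

lemma degree_irreducible_pos:
  fixes p :: "'a::field poly"
  assumes "irreducible p"
  shows "0 < degree p"
  using assms is_unit_iff_degree[of p] by (auto simp: irreducible_def)

text \<open>Among the monic nonconstant divisors of \<open>h\<close>, one of least degree is
  irreducible: a nonconstant proper factor, rescaled to be monic, would be a smaller one.\<close>

lemma obtain_monic_irreducible_divisor:
  fixes h :: "'a::field poly"
  assumes h: "h \<noteq> 0" "\<not> is_unit h"
  obtains p where "p \<in> monic_irreducible_divisors h"
proof -
  define P where "P p \<longleftrightarrow> lead_coeff p = 1 \<and> 0 < degree p \<and> p dvd h" for p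
  have normalized: "P (smult (inverse (lead_coeff a)) a)" if "0 < degree a" "a dvd h" for a
  proof -
    have "a \<noteq> 0"
      using that by auto
    then show ?thesis
      using that by (simp add: P_def smult_dvd_iff)
  qed
  have "0 < degree h"
    using h is_unit_iff_degree by blast
  then have "\<exists>p. P p"
    using normalized[of h] by auto
  then obtain p where p: "P p" and min: "\<And>a. P a \<Longrightarrow> degree p \<le> degree a"
    using ex_has_least_nat[of P _ degree] by blast
  have [simp]: "p \<noteq> 0"
    using p by (auto simp: P_def)
  have "irreducible p"
  proof (rule irreducibleI)
    show "\<not> is_unit p"
      using p is_unit_iff_degree[of p] by (auto simp: P_def)
  next
    fix a b
    assume ab: "p = a * b"
    then have nz: "a \<noteq> 0" "b \<noteq> 0"
      using \<open>p \<noteq> 0\<close> by auto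
    show "is_unit a \<or> is_unit b"
    proof (rule ccontr)
      assume "\<not> ?thesis"
      then have deg: "0 < degree a" "0 < degree b"
        using nz is_unit_iff_degree by blast+
      have "a dvd h"
        using p ab by (auto simp: P_def dest: dvd_mult_left)
      then have "degree p \<le> degree a"
        using min[OF normalized[OF deg(1)]] nz by simp
      then show False
        using deg ab nz by (simp add: degree_mult_eq)
    qed
  qed simp
  then show ?thesis
    using that p by (auto simp: P_def monic_irreducible_divisors_def)
qed

lemma finite_monic_irreducible_divisors:
  fixes g :: "'a::{finite,field} poly"
  assumes "g \<noteq> 0"
  shows "finite (monic_irreducible_divisors g)"
proof (rule finite_subset)
  show "monic_irreducible_divisors g \<subseteq> (\<Union>n\<le>degree g. monic_polys n)"
    using assms by (auto simp: monic_irreducible_divisors_def monic_polys_def dvd_imp_degree_le)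
qed simp

lemma prime_elem_dvd_prod:
  assumes "prime_elem p" "finite A" "p dvd prod f A"
  shows "\<exists>x\<in>A. p dvd f x"
  using assms(2,3)
proof (induction A rule: finite_induct)
  case empty
  then show ?case
    using assms(1) by (simp add: prime_elem_not_unit)
next
  case (insert a A)
  then show ?case
    using assms(1) by (auto simp: prime_elem_dvd_mult_iff)
qed

text \<open>Lets the pattern of the square-free part be computed from \<open>g\<close> itself.
  Irreducibles are prime, so one that divides the product divides some factor and, both being monic,
  equals it.\<close>

lemma monic_irreducible_divisors_monic_radical:
  fixes g :: "'a::{finite,field} poly"
  assumes "g \<noteq> 0"
  shows "monic_irreducible_divisors (monic_radical g) = monic_irreducible_divisors g"
proof -
  have rad: "monic_radical g = (\<Prod>r\<in>monic_irreducible_divisors g. r)"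
    by (simp add: monic_radical_def monic_irreducible_divisors_def)
  have fin: "finite (monic_irreducible_divisors g)"
    using assms by (rule finite_monic_irreducible_divisors)
  have "p \<in> monic_irreducible_divisors g" if "p \<in> monic_irreducible_divisors (monic_radical g)" for p
  proof -
    have p: "lead_coeff p = 1" "irreducible p" "p dvd monic_radical g"
      using that by (auto simp: monic_irreducible_divisors_def)
    then obtain r where r: "r \<in> monic_irreducible_divisors g" "p dvd r"
      using prime_elem_dvd_prod[OF field_poly_irreducible_imp_prime[OF p(2)] fin] p(3)
      unfolding rad by auto
    then have "p = r"
      using p by (intro monic_irreducible_dvd_imp_eq) (auto simp: monic_irreducible_divisors_def)
    then show ?thesis
      using r by simp
  qed
  moreover have "p \<in> monic_irreducible_divisors (monic_radical g)"
    if "p \<in> monic_irreducible_divisors g" for p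
    using that dvd_prodI[OF fin that, of "\<lambda>r. r"] unfolding rad
    by (auto simp: monic_irreducible_divisors_def)
  ultimately show ?thesis
    by blast
qed

text \<open>Any non-unit common divisor is nonzero because \<open>g\<close> is, so it has a monic
  irreducible divisor, which then divides both \<open>g\<close> and \<open>f\<close>.\<close>

lemma coprime_iff_no_common_monic_irreducible:
  fixes g f :: "'a::field poly"
  assumes "g \<noteq> 0"
  shows "coprime g f \<longleftrightarrow> (\<forall>p\<in>monic_irreducible_divisors g. \<not> p dvd f)"
proof
  assume "coprime g f"
  then show "\<forall>p\<in>monic_irreducible_divisors g. \<not> p dvd f"
    by (auto simp: monic_irreducible_divisors_def irreducible_def dest: coprime_common_divisor)
next
  assume *: "\<forall>p\<in>monic_irreducible_divisors g. \<not> p dvd f"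
  show "coprime g f"
  proof (rule ccontr)
    assume "\<not> coprime g f"
    then obtain c where c: "c dvd g" "c dvd f" "\<not> is_unit c"
      by (rule not_coprimeE)
    moreover have "c \<noteq> 0"
      using c assms by auto
    ultimately obtain p where "p \<in> monic_irreducible_divisors c"
      using obtain_monic_irreducible_divisor by blast
    then have "p \<in> monic_irreducible_divisors g" "p dvd f"
      using c by (auto simp: monic_irreducible_divisors_def intro: dvd_trans)
    then show False
      using * by blast
  qed
qed

text \<open>Write \<open>f = p * h\<close>. The prime \<open>r\<close> divides one of the two
  factors, and it cannot divide \<open>p\<close> without being equal to it.\<close>

lemma distinct_monic_irreducible_mult_dvd:
  fixes p r f :: "'a::field poly"
  assumes p: "lead_coeff p = 1" "irreducible p" and r: "lead_coeff r = 1" "irreducible r"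
    and neq: "p \<noteq> r" and dvd: "p dvd f" "r dvd f"
  shows "p * r dvd f"
proof -
  obtain h where h: "f = p * h"
    using dvd by blast
  have "r dvd p \<or> r dvd h"
    using dvd(2) field_poly_irreducible_imp_prime[OF r(2)] h by (auto simp: prime_elem_dvd_mult_iff)
  moreover have "\<not> r dvd p"
    using monic_irreducible_dvd_imp_eq[OF r p] neq by auto
  ultimately show ?thesis
    using h by (auto intro: mult_dvd_mono)
qed

text \<open>Dividing \<open>g\<close> by one member \<open>p\<close> lowers the degree by at least
  1, while the remaining members still divide the quotient.\<close>

lemma card_le_degree_of_irreducible_divisors:
  fixes g :: "'a::field poly"
  assumes "finite S" "g \<noteq> 0" "S \<subseteq> monic_irreducible_divisors g"
  shows "card S \<le> degree g"
  using assms
proof (induction S arbitrary: g rule: finite_induct)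
  case (insert p S)
  have p: "lead_coeff p = 1" "irreducible p" "p dvd g"
    using insert.prems by (auto simp: monic_irreducible_divisors_def)
  then obtain h where h: "g = p * h"
    by blast
  have nz: "p \<noteq> 0" "h \<noteq> 0"
    using h insert.prems by auto
  have "S \<subseteq> monic_irreducible_divisors h"
  proof
    fix r
    assume r: "r \<in> S"
    have r': "lead_coeff r = 1" "irreducible r" "r dvd g"
      using r insert.prems by (auto simp: monic_irreducible_divisors_def)
    have "p * r dvd p * h"
      using distinct_monic_irreducible_mult_dvd[OF p(1,2) r'(1,2) _ p(3) r'(3)] r insert.hyps h by auto
    then show "r \<in> monic_irreducible_divisors h"
      using r' nz by (simp add: monic_irreducible_divisors_def)
  qed
  then have "card S \<le> degree h"
    using insert.IH nz by blast
  then show ?case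
    using insert.hyps h nz degree_irreducible_pos[OF p(2)] by (simp add: degree_mult_eq)
qed simp

text \<open>Bonferroni's inequality with a uniform bound \<open>M\<close> on pairwise intersections.
  A new index forms \<open>card I\<close> new pairs with the old ones, which is the increment of the
  binomial coefficient by Pascal's rule. The pair term stands on the right to avoid truncated
  subtraction.\<close>

lemma sum_card_le_card_Union_plus_pairs:
  assumes "finite I" "\<And>i. i \<in> I \<Longrightarrow> finite (A i)"
    and "\<And>i j. i \<in> I \<Longrightarrow> j \<in> I \<Longrightarrow> i \<noteq> j \<Longrightarrow> card (A i \<inter> A j) \<le> M"
  shows "(\<Sum>i\<in>I. card (A i)) \<le> card (\<Union>i\<in>I. A i) + (card I choose 2) * M"
  using assms
proof (induction I rule: finite_induct)
  case (insert i I)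
  let ?U = "\<Union>j\<in>I. A j"
  have "card (A i) + card ?U = card (A i \<union> ?U) + card (A i \<inter> ?U)"
    using insert by (intro card_Un_Int) auto
  moreover have "card (A i \<inter> ?U) \<le> card I * M"
  proof -
    have "card (A i \<inter> ?U) = card (\<Union>j\<in>I. A i \<inter> A j)"
      by (rule arg_cong[of _ _ card]) auto
    also have "\<dots> \<le> (\<Sum>j\<in>I. card (A i \<inter> A j))"
      using insert by (intro card_UN_le)
    also have "\<dots> \<le> (\<Sum>j\<in>I. M)"
      using insert by (intro sum_mono) auto
    finally show ?thesis
      by simp
  qed
  moreover have "(\<Sum>j\<in>I. card (A j)) \<le> card ?U + (card I choose 2) * M"
    using insert by auto
  moreover have "(card (insert i I) choose 2) = card I + (card I choose 2)"
    using insert.hyps by (simp add: numeral_2_eq_2)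
  ultimately show ?case
    using insert.hyps by (simp add: algebra_simps)
qed simp

section \<open>The two estimates for \<open>P0\<close>\<close>

lemma card_B0:
  fixes g :: "'a::{finite,field} poly"
  assumes "g \<noteq> 0"
  shows "card (B0 g d) + card (\<Union>p\<in>monic_irreducible_divisors g. {f \<in> monic_polys d. p dvd f})
         = CARD('a) ^ d"
proof -
  let ?U = "\<Union>p\<in>monic_irreducible_divisors g. {f \<in> monic_polys d. p dvd f}"
  have "B0 g d = monic_polys d - ?U"
    using coprime_iff_no_common_monic_irreducible[OF assms] by (auto simp: B0_def monic_polys_def)
  moreover have sub: "?U \<subseteq> monic_polys d"
    by auto
  moreover have "card ?U \<le> card (monic_polys d :: 'a poly set)"
    using sub by (intro card_mono) auto
  moreover have "card (monic_polys d - ?U) = card (monic_polys d :: 'a poly set) - card ?U"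
    using sub by (intro card_Diff_subset finite_subset[OF sub]) auto
  ultimately show ?thesis
    by (simp add: card_monic_polys)
qed

text \<open>The union bound divided by \<open>CARD('a) ^ d\<close>. Divisors of degree above
  \<open>d\<close> drop out of the sum, since they have no monic multiples of degree
  \<open>d\<close>.\<close>

lemma P0_ge:
  fixes g :: "'a::{finite,field} poly"
  assumes g: "g \<noteq> 0"
  shows "1 - (\<Sum>p\<in>{p \<in> monic_irreducible_divisors g. degree p \<le> d}. 1 / real CARD('a) ^ degree p)
         \<le> P0 g d"
proof -
  let ?q = "CARD('a)"
  let ?S = "monic_irreducible_divisors g"
  let ?A = "\<lambda>p. {f \<in> monic_polys d. p dvd f}"
  have fin: "finite ?S"
    using g by (rule finite_monic_irreducible_divisors)
  have "card (\<Union>p\<in>?S. ?A p) \<le> (\<Sum>p\<in>?S. card (?A p))"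
    using fin by (rule card_UN_le)
  also have "\<dots> = (\<Sum>p\<in>?S. if degree p \<le> d then ?q ^ (d - degree p) else 0)"
    by (intro sum.cong refl card_monic_multiples) (auto simp: monic_irreducible_divisors_def)
  also have "\<dots> = (\<Sum>p\<in>{p \<in> ?S. degree p \<le> d}. ?q ^ (d - degree p))"
    using fin by (rule sum.inter_filter[symmetric])
  finally have "?q ^ d \<le> card (B0 g d) + (\<Sum>p\<in>{p \<in> ?S. degree p \<le> d}. ?q ^ (d - degree p))"
    using card_B0[OF g, of d] by linarith
  then have "real (?q ^ d) \<le> real (card (B0 g d) + (\<Sum>p\<in>{p \<in> ?S. degree p \<le> d}. ?q ^ (d - degree p)))"
    by (rule of_nat_mono)
  also have "\<dots> = real (card (B0 g d)) + (\<Sum>p\<in>{p \<in> ?S. degree p \<le> d}. real ?q ^ (d - degree p))"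
    by simp
  also have "(\<Sum>p\<in>{p \<in> ?S. degree p \<le> d}. real ?q ^ (d - degree p))
      = real ?q ^ d * (\<Sum>p\<in>{p \<in> ?S. degree p \<le> d}. 1 / real ?q ^ degree p)"
    unfolding sum_distrib_left by (intro sum.cong refl) (auto simp: power_diff)
  finally show ?thesis
    by (simp add: P0_def field_simps)
qed

text \<open>Bonferroni is applied to the divisors of degree \<open>k\<close> alone; discarding the
  others can only shrink the union of bad sets, so it still bounds the bad polynomials from
  below.\<close>

lemma P0_le:
  fixes g :: "'a::{finite,field} poly"
  assumes g: "g \<noteq> 0" and k: "k \<le> d"
  defines "n \<equiv> card {p \<in> monic_irreducible_divisors g. degree p = k}"
  shows "P0 g d \<le> 1 - real n / real CARD('a) ^ k
                   + real (n choose 2) * (1 / real CARD('a) ^ min (2 * k) d)"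
proof -
  let ?q = "CARD('a)"
  let ?I = "{p \<in> monic_irreducible_divisors g. degree p = k}"
  let ?A = "\<lambda>p. {f \<in> monic_polys d. p dvd f}"
  let ?m = "min (2 * k) d"
  have fin: "finite (monic_irreducible_divisors g)"
    using g by (rule finite_monic_irreducible_divisors)
  \<comment> \<open>If \<open>2 * k \<le> d\<close>, the multiples of \<open>p * r\<close> number
    exactly \<open>?q ^ (d - 2 * k)\<close>. Otherwise there are none, and the bound is
    \<open>?q ^ 0 = 1\<close>; this is where the minimum in the exponent comes from.\<close>
  have pair: "card (?A p \<inter> ?A r) \<le> ?q ^ (d - ?m)" if "p \<in> ?I" "r \<in> ?I" "p \<noteq> r" for p r
  proof -
    have p: "lead_coeff p = 1" "irreducible p" and r: "lead_coeff r = 1" "irreducible r"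
      and deg: "degree p = k" "degree r = k"
      using that by (auto simp: monic_irreducible_divisors_def)
    have "p \<noteq> 0" "r \<noteq> 0"
      using p r by auto
    then have "degree (p * r) = 2 * k"
      using deg by (simp add: degree_mult_eq)
    moreover have "lead_coeff (p * r) = 1"
      using p r by (simp only: lead_coeff_mult mult_1)
    ultimately have "card (?A (p * r)) \<le> ?q ^ (d - ?m)"
      by (subst card_monic_multiples) auto
    moreover have "card (?A p \<inter> ?A r) \<le> card (?A (p * r))"
      using distinct_monic_irreducible_mult_dvd[OF p r that(3)] by (intro card_mono) auto
    ultimately show ?thesis
      by linarith
  qed
  have "card (?A p) = ?q ^ (d - k)" if "p \<in> ?I" for p
    using that k by (subst card_monic_multiples) (auto simp: monic_irreducible_divisors_def)
  then have "n * ?q ^ (d - k) = (\<Sum>p\<in>?I. card (?A p))"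
    by (simp add: n_def)
  also have "\<dots> \<le> card (\<Union>p\<in>?I. ?A p) + (n choose 2) * ?q ^ (d - ?m)"
    unfolding n_def using fin pair by (intro sum_card_le_card_Union_plus_pairs) auto
  also have "card (\<Union>p\<in>?I. ?A p) \<le> card (\<Union>p\<in>monic_irreducible_divisors g. ?A p)"
    using fin by (intro card_mono) auto
  finally have "card (B0 g d) + n * ?q ^ (d - k) \<le> ?q ^ d + (n choose 2) * ?q ^ (d - ?m)"
    using card_B0[OF g, of d] by linarith
  then have "real (card (B0 g d) + n * ?q ^ (d - k)) \<le> real (?q ^ d + (n choose 2) * ?q ^ (d - ?m))"
    by (rule of_nat_mono)
  then have "real (card (B0 g d)) + real n * real ?q ^ (d - k)
      \<le> real ?q ^ d + real (n choose 2) * real ?q ^ (d - ?m)"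
    by simp
  \<comment> \<open>Both \<open>k\<close> and \<open>?m\<close> are at most \<open>d\<close>, so the
    natural subtractions in the exponents do not truncate and become quotients of powers.\<close>
  moreover have "real ?q ^ (d - k) = real ?q ^ d / real ?q ^ k"
    using k by (simp add: power_diff)
  moreover have "real ?q ^ (d - ?m) = real ?q ^ d / real ?q ^ ?m"
    by (intro power_diff) auto
  ultimately have "real (card (B0 g d))
      \<le> real ?q ^ d * (1 - real n / real ?q ^ k + real (n choose 2) * (1 / real ?q ^ ?m))"
    by (simp add: algebra_simps)
  then show ?thesis
    by (simp add: P0_def divide_le_eq mult.commute)
qed

theorem theorem4p2:
  fixes g :: "'a::{finite,field} poly"
    and q d e k :: nat
    and lam :: "nat \<Rightarrow> nat"
  assumes q: "q = CARD('a)"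
    and d: "0 < d" and e: "d < e"
    and monic: "lead_coeff g = 1" and deg: "degree g = e"
    and pattern: "lam = factorization_pattern (monic_radical g)"
    and k: "k = (LEAST i. 0 < lam i)"
  shows "(k \<le> d \<longrightarrow>
            1 - real (lam k) / real q ^ k - (\<Sum>i=k+1..d. real (lam i) / real q ^ i) \<le> P0 g d \<and>
            P0 g d \<le> 1 - real (lam k) / real q ^ k
                      + real (lam k choose 2) * (1 / real q ^ min (2 * k) d)) \<and>
         (2 * e < q \<longrightarrow> 1 / 2 < P0 g d)"
proof -
  let ?S = "monic_irreducible_divisors g"
  let ?T = "{p \<in> ?S. degree p \<le> d}"
  have g: "g \<noteq> 0"
    using monic by auto
  have fin: "finite ?S"
    using g by (rule finite_monic_irreducible_divisors)
  have lam: "lam i = card {p \<in> ?S. degree p = i}" for i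
    unfolding pattern factorization_pattern_def monic_irreducible_divisors_monic_radical[OF g, symmetric]
    by (simp add: monic_irreducible_divisors_def conj_assoc)
  have lower: "1 - real (lam k) / real q ^ k - (\<Sum>i=k+1..d. real (lam i) / real q ^ i) \<le> P0 g d"
    if "k \<le> d"
  proof -
    \<comment> \<open>A divisor \<open>p\<close> witnesses that \<open>lam\<close> is positive at
      its degree, so minimality of \<open>k\<close> applies. Hence grouping \<open>?T\<close> by
      degree uses only the indices from \<open>k\<close> to \<open>d\<close>.\<close>
    have min_degree: "k \<le> degree p" if "p \<in> ?S" for p
    proof -
      have "0 < lam (degree p)"
        using that fin by (auto simp: lam card_gt_0_iff)
      then show ?thesis
        unfolding k by (rule Least_le)
    qed
    have "(\<Sum>p\<in>?T. 1 / real q ^ degree p)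
        = (\<Sum>i=k..d. \<Sum>p\<in>{p \<in> ?T. degree p = i}. 1 / real q ^ degree p)"
      using fin min_degree by (intro sum.group[symmetric]) auto
    also have "\<dots> = (\<Sum>i=k..d. real (lam i) / real q ^ i)"
    proof (intro sum.cong refl)
      fix i
      assume "i \<in> {k..d}"
      then have "{p \<in> ?T. degree p = i} = {p \<in> ?S. degree p = i}"
        by auto
      then show "(\<Sum>p\<in>{p \<in> ?T. degree p = i}. 1 / real q ^ degree p) = real (lam i) / real q ^ i"
        by (simp add: lam)
    qed
    also have "\<dots> = real (lam k) / real q ^ k + (\<Sum>i=k+1..d. real (lam i) / real q ^ i)"
      using that by (simp add: sum.atLeast_Suc_atMost)
    finally show ?thesis
      using P0_ge[OF g, of d] by (simp add: q)
  qed
  \<comment> \<open>The loss in \<open>P0_ge\<close> is bounded directly instead of through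
    \<open>lower\<close>, so that the case \<open>d < k\<close> is covered too: at most
    \<open>e\<close> divisors, each of degree at least 1, lose at most \<open>e / q\<close> in
    total.\<close>
  have half: "1 / 2 < P0 g d" if "2 * e < q"
  proof -
    have "(\<Sum>p\<in>?T. 1 / real q ^ degree p) \<le> (\<Sum>p\<in>?T. 1 / real q)"
    proof (intro sum_mono)
      fix p
      assume "p \<in> ?T"
      then have "0 < degree p"
        by (auto simp: monic_irreducible_divisors_def intro: degree_irreducible_pos)
      then have "real q \<le> real q ^ degree p"
        using that by (intro self_le_power) auto
      then show "1 / real q ^ degree p \<le> 1 / real q"
        using that by (intro divide_left_mono) auto
    qed
    also have "\<dots> = real (card ?T) / real q"
      by simp
    also have "\<dots> \<le> real e / real q"
      using card_le_degree_of_irreducible_divisors[of ?T g] fin g deg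
      by (intro divide_right_mono) auto
    also have "\<dots> < 1 / 2"
      using that by (simp add: divide_less_eq)
    finally show ?thesis
      using P0_ge[OF g, of d] by (simp add: q)
  qed
  show ?thesis
    using lower half P0_le[OF g, of k d] by (simp add: lam q)
qed

end
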